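(* Let $d\in\mathbb{N}$ and let $\phi\colon (0,\infty)\to(0,\infty)$ be an increasing, concave function. Then $\phi$-displacement equivalence is an equivalence relation on the set of separated nets of $\mathbb{R}^{d}$.
   Context: A set $Z\subseteq\mathbb{R}^d$ is separated if $\inf\{\|z-z'\|_2: z,z'\in Z,\ z\ne z'\}>0$, and a net of $\mathbb{R}^d$ if $\sup_{x\in\mathbb{R}^d}\inf_{z\in Z}\|z-x\|_2<\infty$; a separated net is a set that is both. A function $\phi$ is increasing if $s\le t$ implies $\phi(s)\le\phi(t)$. For $f\colon A\subseteq\mathbb{R}^d\to\mathbb{R}^d$ and $R>0$, $\operatorname{disp}_R(f):=\sup\{\|f(x)-x\|_2: x\in A,\ \|x\|_2\le R\}$, with $\operatorname{disp}_R(f):=0$ if $A\cap\overline{B}(\mathbf{0},R)=\emptyset$. Separated nets $X,Y\subseteq\mathbb{R}^d$ are called $\phi$-displacement equivalent if there is a bijection $f\colon X\to Y$ with $\operatorname{disp}_R(f)\in O(\phi(R))$, i.e. $\limsup_{R\to\infty}\operatorname{disp}_R(f)/\phi(R)<\infty$. *)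

theory Defs
  imports "HOL-Analysis.Analysis"
begin

text \<open>
  Suprema and infima are taken in \<^typ>\<open>ereal\<close>, so that the infimum of the empty set is
  \<open>\<infinity>\<close>: sets with at most one point are separated, and the empty set is not a net.
\<close>

definition separated :: "(real ^ 'n) set \<Rightarrow> bool" where
  "separated Z \<longleftrightarrow> Inf {ereal (norm (z - z')) | z z'. z \<in> Z \<and> z' \<in> Z \<and> z \<noteq> z'} > 0"

definition net :: "(real ^ 'n) set \<Rightarrow> bool" where
  "net Z \<longleftrightarrow> (SUP x. INF z\<in>Z. ereal (norm (z - x))) < \<infinity>"

definition separated_net :: "(real ^ 'n) set \<Rightarrow> bool" where
  "separated_net Z \<longleftrightarrow> separated Z \<and> net Z"

text \<open>
  The domain \<open>A\<close> of the partial function \<open>f\<close> is an explicit argument. The separate case for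
  an empty intersection is needed because the \<^typ>\<open>ereal\<close> supremum of the empty set is
  \<open>-\<infinity>\<close>.
\<close>

definition disp :: "(real ^ 'n) set \<Rightarrow> (real ^ 'n \<Rightarrow> real ^ 'n) \<Rightarrow> real \<Rightarrow> ereal" where
  "disp A f R =
    (if A \<inter> cball 0 R = {} then 0
     else Sup {ereal (norm (f x - x)) | x. x \<in> A \<and> norm x \<le> R})"

definition displacement_equivalent ::
    "(real \<Rightarrow> real) \<Rightarrow> (real ^ 'n) set \<Rightarrow> (real ^ 'n) set \<Rightarrow> bool" where
  "displacement_equivalent \<phi> X Y \<longleftrightarrow>
    separated_net X \<and> separated_net Y \<and>
    (\<exists>f. bij_betw f X Y \<and> Limsup at_top (\<lambda>R. disp X f R / ereal (\<phi> R)) < \<infinity>)"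

end

theory Submission
  imports Defs
begin

text \<open>
  Concavity and positivity make \<open>\<phi> t / t\<close> nonincreasing on \<open>(0, \<infinity>)\<close>
  (\<open>quotient_antimono\<close>). Consequently \<open>\<phi>\<close> grows at most linearly
  and \<open>\<phi> (K * t) \<le> K * \<phi> t\<close> for \<open>K \<ge> 1\<close>. It also follows that a bijection \<open>f\<close> witnesses
  equivalence precisely if \<open>norm (f x - x) \<le> C * \<phi> (max 1 (norm x))\<close> for some constant \<open>C\<close> and all
  points \<open>x\<close> of the domain (\<open>Limsup_disp_finite_iff\<close>): the asymptotic condition becomes a pointwise
  one.

  Reflexivity is witnessed by the identity and transitivity by the composition: \<open>f\<close> maps a point of
  norm at most \<open>R \<ge> 1\<close> to a point of norm at most \<open>K * R\<close>, where the displacement of the second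
  bijection is still of order \<open>\<phi> R\<close>.

  Symmetry is the delicate part, because the inverse of a witness \<open>f\<close> need not be a witness: if
  \<open>\<phi>\<close> is linear, then \<open>f\<close> may send points of enormous norm close to the origin. There are two cases.

  \<^item> If \<open>\<phi> t / t\<close> tends to \<open>0\<close>, then \<open>f\<close> moves a point \<open>x\<close> of large norm by at most
    \<open>norm x / 2\<close>. Hence \<open>norm x \<le> 2 * norm (f x)\<close>, and the inverse of \<open>f\<close> is a witness
    (\<open>bounded_displacement_inverse_if_sublinear\<close>).

  \<^item> Otherwise \<open>\<phi>\<close> has a linear lower bound, and any two separated nets \<open>X\<close> and \<open>Y\<close> are
    equivalent (\<open>separated_nets_linear_bijection\<close>). Choosing for each \<open>x \<in> X\<close> a point of \<open>Y\<close> near \<open>\<lambda> * x\<close>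
    gives, for large \<open>\<lambda>\<close>, an injection \<open>X \<rightarrow> Y\<close> that changes norms by a bounded factor in both
    directions, up to an additive constant. There is such an injection \<open>Y \<rightarrow> X\<close> too, and the
    Schroeder-Bernstein construction merges the two into a bijection which at each point agrees with
    the first or with the inverse of the second, so that it moves points linearly.
\<close>

section \<open>Increasing concave functions\<close>

locale displacement_gauge =
  fixes \<phi> :: "real \<Rightarrow> real"
  assumes pos: "t > 0 \<Longrightarrow> \<phi> t > 0"
    and mono: "mono_on {0<..} \<phi>"
    and concave: "concave_on {0<..} \<phi>"
begin

lemma mono': "0 < s \<Longrightarrow> s \<le> t \<Longrightarrow> \<phi> s \<le> \<phi> t"
  using mono by (auto simp: mono_on_def)

text \<open>
  The quotient \<open>\<phi> t / t\<close> is the slope of the chord from the origin to the graph of \<open>\<phi>\<close>. As \<open>0\<close>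
  is not in the domain, the chord starts at a small \<open>\<epsilon> > 0\<close> instead, and \<open>\<epsilon>\<close> then tends to \<open>0\<close>.
\<close>

lemma quotient_antimono:
  assumes "0 < s" "s \<le> t"
  shows "s * \<phi> t \<le> t * \<phi> s"
proof (cases "s = t")
  case False
  with assms have st: "s < t" by simp
  have chord: "s * \<phi> t - t * \<phi> s \<le> e * (\<phi> t - \<phi> s)" if e: "0 < e" "e < s" for e
  proof -
    define u where "u = (s - e) / (t - e)"
    have te: "t - e > 0" using e st by simp
    have u: "0 \<le> u" "u \<le> 1" using e st by (auto simp: u_def divide_simps)
    have ut: "u * (t - e) = s - e" using te by (simp add: u_def)
    have "(1 - u) * e + u * t = s" using ut by (simp add: algebra_simps)
    with concave_onD[OF concave u, of e t] e st
    have "(1 - u) * \<phi> e + u * \<phi> t \<le> \<phi> s" by simp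
    moreover have "0 \<le> (1 - u) * \<phi> e" using u pos[of e] e by simp
    ultimately have "u * \<phi> t \<le> \<phi> s" by simp
    hence "(u * \<phi> t) * (t - e) \<le> \<phi> s * (t - e)" using te by (simp add: mult_right_mono)
    moreover have "(u * \<phi> t) * (t - e) = (s - e) * \<phi> t" by (simp flip: ut)
    ultimately show ?thesis by (simp add: algebra_simps)
  qed
  have "((\<lambda>e. e * (\<phi> t - \<phi> s)) \<longlongrightarrow> 0 * (\<phi> t - \<phi> s)) (at_right 0)"
    by (intro tendsto_intros)
  hence lim: "((\<lambda>e. e * (\<phi> t - \<phi> s)) \<longlongrightarrow> 0) (at_right 0)" by simp
  have "eventually (\<lambda>e. s * \<phi> t - t * \<phi> s \<le> e * (\<phi> t - \<phi> s)) (at_right 0)"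
    using assms(1) chord by (auto simp: eventually_at_right_field)
  from tendsto_lowerbound[OF lim this] show ?thesis by simp
qed simp

lemma dilation_le:
  assumes "1 \<le> K" "0 < t"
  shows "\<phi> (K * t) \<le> K * \<phi> t"
proof -
  have "t * \<phi> (K * t) \<le> (K * t) * \<phi> t" using assms by (intro quotient_antimono) auto
  hence "t * \<phi> (K * t) \<le> t * (K * \<phi> t)" by (simp add: mult_ac)
  thus ?thesis using assms by simp
qed

section \<open>Displacement equivalence as a pointwise estimate\<close>

text \<open>
  The truncation at \<open>1\<close> is there because \<open>\<phi> t\<close> may tend to \<open>0\<close> as \<open>t\<close> does, whereas displacements
  of points near the origin are only required to be bounded.
\<close>

definition bounded_displacement :: "(real ^ 'n) set \<Rightarrow> (real ^ 'n \<Rightarrow> real ^ 'n) \<Rightarrow> bool" where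
  "bounded_displacement X f \<longleftrightarrow>
    (\<exists>C\<ge>0. \<forall>x\<in>X. norm (f x - x) \<le> C * \<phi> (max 1 (norm x)))"

text \<open>
  If \<open>disp X f R \<le> C * \<phi> R\<close> for \<open>R \<ge> N\<close>, then taking \<open>R = N * max 1 (norm x)\<close> covers every point
  \<open>x\<close> at once, at the price of replacing \<open>C\<close> by \<open>C * N\<close>.
\<close>

lemma Limsup_disp_finite_iff:
  "Limsup at_top (\<lambda>R. disp X f R / ereal (\<phi> R)) < \<infinity> \<longleftrightarrow> bounded_displacement X f"
proof
  assume "Limsup at_top (\<lambda>R. disp X f R / ereal (\<phi> R)) < \<infinity>"
  hence "Limsup at_top (\<lambda>R. disp X f R / ereal (\<phi> R)) \<noteq> \<infinity>" by simp
  then obtain c where c: "Limsup at_top (\<lambda>R. disp X f R / ereal (\<phi> R)) < ereal c"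
    unfolding less_PInf_Ex_of_nat by blast
  from Limsup_lessD[OF this] obtain N0 where
    N0: "\<And>R. R \<ge> N0 \<Longrightarrow> disp X f R / ereal (\<phi> R) < ereal c"
    by (auto simp: eventually_at_top_linorder)
  define C where "C = max 0 c"
  define N where "N = max 1 N0"
  have N1: "1 \<le> N" by (simp add: N_def)
  have C0: "0 \<le> C" by (simp add: C_def)
  have "norm (f x - x) \<le> (C * N) * \<phi> (max 1 (norm x))" if x: "x \<in> X" for x
  proof -
    define m where "m = max 1 (norm x)"
    define R where "R = N * m"
    have m: "1 \<le> m" "norm x \<le> m" by (auto simp: m_def)
    have "N * 1 \<le> R" unfolding R_def using m N1 by (intro mult_left_mono) auto
    moreover have "1 * m \<le> R" unfolding R_def using m N1 by (intro mult_right_mono) auto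
    ultimately have R: "N \<le> R" "norm x \<le> R" "0 < R" using m N1 by linarith+
    have "N0 \<le> R" using R by (simp add: N_def)
    have "ereal (norm (f x - x)) \<le> disp X f R"
      using x R by (auto simp: disp_def intro!: Sup_upper)
    moreover have "disp X f R \<le> ereal c * ereal (\<phi> R)"
      using N0[OF \<open>N0 \<le> R\<close>] pos[OF \<open>0 < R\<close>] by (simp add: ereal_divide_less_pos mult.commute less_imp_le)
    ultimately have "ereal (norm (f x - x)) \<le> ereal (c * \<phi> R)"
      by (metis order_trans times_ereal.simps(1))
    hence "norm (f x - x) \<le> c * \<phi> R" by simp
    also have "\<dots> \<le> C * \<phi> R" using pos[OF \<open>0 < R\<close>] by (simp add: C_def mult_right_mono)
    also have "\<dots> \<le> C * (N * \<phi> m)"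
      unfolding R_def using m N1 C0 by (intro mult_left_mono dilation_le) auto
    finally show ?thesis by (simp add: m_def mult.assoc)
  qed
  thus "bounded_displacement X f" unfolding bounded_displacement_def using C0 N1
    by (intro exI[of _ "C * N"]) auto
next
  assume "bounded_displacement X f"
  then obtain C where C0: "0 \<le> C"
    and C: "\<And>x. x \<in> X \<Longrightarrow> norm (f x - x) \<le> C * \<phi> (max 1 (norm x))"
    by (auto simp: bounded_displacement_def)
  have "disp X f R / ereal (\<phi> R) \<le> ereal C" if R: "R \<ge> 1" for R
  proof -
    have p: "0 < \<phi> R" using R pos by simp
    have "norm (f x - x) \<le> C * \<phi> R" if "x \<in> X" "norm x \<le> R" for x
    proof -
      have "\<phi> (max 1 (norm x)) \<le> \<phi> R" using that R by (intro mono') auto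
      from mult_left_mono[OF this C0] C[OF \<open>x \<in> X\<close>] show ?thesis by linarith
    qed
    hence "disp X f R \<le> ereal (C * \<phi> R)"
      using C0 p by (auto simp: disp_def intro!: Sup_least)
    thus ?thesis using p by (simp add: ereal_divide_le_pos mult.commute)
  qed
  hence "Limsup at_top (\<lambda>R. disp X f R / ereal (\<phi> R)) \<le> ereal C"
    by (intro Limsup_bounded) (auto simp: eventually_at_top_linorder)
  thus "Limsup at_top (\<lambda>R. disp X f R / ereal (\<phi> R)) < \<infinity>"
    by (rule le_less_trans) simp
qed

lemma displacement_equivalent_iff:
  "displacement_equivalent \<phi> X Y \<longleftrightarrow>
    separated_net X \<and> separated_net Y \<and> (\<exists>f. bij_betw f X Y \<and> bounded_displacement X f)"
  unfolding displacement_equivalent_def Limsup_disp_finite_iff ..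

end

section \<open>Any two separated nets are linearly displaced from each other\<close>

lemma separatedE:
  assumes "separated Z"
  obtains \<delta> where "\<delta> > 0" "\<And>z z'. z \<in> Z \<Longrightarrow> z' \<in> Z \<Longrightarrow> z \<noteq> z' \<Longrightarrow> \<delta> \<le> norm (z - z')"
proof -
  from assms obtain e where e: "0 < e"
      "e < Inf {ereal (norm (z - z')) | z z'. z \<in> Z \<and> z' \<in> Z \<and> z \<noteq> z'}"
    unfolding separated_def by (blast dest: dense)
  then obtain \<delta> where \<delta>: "e = ereal \<delta>" by (cases e) auto
  have "\<delta> \<le> norm (z - z')" if "z \<in> Z" "z' \<in> Z" "z \<noteq> z'" for z z'
  proof -
    have "Inf {ereal (norm (z - z')) | z z'. z \<in> Z \<and> z' \<in> Z \<and> z \<noteq> z'} \<le> ereal (norm (z - z'))"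
      using that by (intro Inf_lower) auto
    from less_le_trans[OF e(2) this] show ?thesis by (simp add: \<delta>)
  qed
  with e \<delta> show ?thesis by (intro that[of \<delta>]) auto
qed

lemma netE:
  assumes "net Z"
  obtains D where "D > 0" "\<And>x. \<exists>z\<in>Z. norm (z - x) \<le> D"
proof -
  from assms obtain n :: nat where "(SUP x. INF z\<in>Z. ereal (norm (z - x))) < ereal (real n)"
    unfolding net_def by (auto simp: less_PInf_Ex_of_nat)
  hence n: "(INF z\<in>Z. ereal (norm (z - x))) < ereal (real n)" for x
    by (meson SUP_lessD UNIV_I)
  have "\<exists>z\<in>Z. norm (z - x) \<le> real n + 1" for x
    using n[of x] by (force simp: INF_less_iff)
  thus ?thesis by (intro that[of "real n + 1"]) auto
qed

text \<open>
  Dilating a \<open>\<delta>\<close>-separated set by \<open>c\<close> pushes distinct points apart by \<open>c * \<delta>\<close>. Once this exceeds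
  \<open>2 * D\<close>, rounding each point to a point of the net at distance at most \<open>D\<close> is injective. This replaces a
  comparison of the numbers of points of the two nets in large balls.
\<close>

lemma separated_net_injection:
  fixes X Y :: "(real ^ 'n) set"
  assumes "separated X" "net Y"
  obtains i c D where "inj_on i X" "i ` X \<subseteq> Y" "1 \<le> c" "0 < D"
    "\<And>x. norm (i x - c *\<^sub>R x) \<le> D"
proof -
  obtain \<delta> where \<delta>: "\<delta> > 0" "\<And>z z'. z \<in> X \<Longrightarrow> z' \<in> X \<Longrightarrow> z \<noteq> z' \<Longrightarrow> \<delta> \<le> norm (z - z')"
    using separatedE[OF assms(1)] by blast
  obtain D where D: "D > 0" "\<And>x. \<exists>z\<in>Y. norm (z - x) \<le> D"
    using netE[OF assms(2)] by blast
  (* The summand 1 ensures c >= 1, so that the injection does not bring points closer to 0 by more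
     than the additive error D; this bounds x in terms of i x. *)
  define c where "c = 3 * D / \<delta> + 1"
  have c1: "1 \<le> c" using D \<delta> by (simp add: c_def)
  have c\<delta>: "2 * D < c * \<delta>" using D(1) \<delta>(1) by (simp add: c_def distrib_right)
  obtain i where i: "\<And>x. i x \<in> Y" "\<And>x. norm (i x - c *\<^sub>R x) \<le> D"
    using bchoice[of UNIV "\<lambda>x z. z \<in> Y \<and> norm (z - c *\<^sub>R x) \<le> D"] D(2) by blast
  have "inj_on i X"
  proof (rule inj_onI, rule ccontr)
    fix x x' assume x: "x \<in> X" "x' \<in> X" "i x = i x'" "x \<noteq> x'"
    have "c * \<delta> \<le> c * norm (x - x')" using \<delta>(2) x c1 by (intro mult_left_mono) auto
    also have "\<dots> = norm (c *\<^sub>R x - c *\<^sub>R x')"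
      using c1 by (simp flip: scaleR_diff_right)
    also have "\<dots> = norm ((i x' - c *\<^sub>R x') - (i x - c *\<^sub>R x))" using x by simp
    also have "\<dots> \<le> D + D" by (rule norm_triangle_le_diff) (intro add_mono i)
    finally show False using c\<delta> by simp
  qed
  with i c1 D(1) show ?thesis by (intro that) auto
qed

text \<open>
  This refines the Schroeder-Bernstein theorem in that the bijection is built from the two given
  injections alone; this is what lets estimates on them carry over to it.
\<close>

lemma Schroeder_Bernstein_graph:
  assumes "inj_on i A" "i ` A \<subseteq> B" "inj_on j B" "j ` B \<subseteq> A"
  obtains h where "bij_betw h A B" "\<And>x. x \<in> A \<Longrightarrow> h x = i x \<or> j (h x) = x"
proof -
  (* S is a subset of A whose complement in A is the j-image of the complement of i ` S in B:
     use i on S and the inverse of j off S. *)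
  define F where "F = (\<lambda>S. A - j ` (B - i ` S))"
  define S where "S = lfp F"
  have "mono F" unfolding F_def by (intro monoI) blast
  hence S: "S = A - j ` (B - i ` S)"
    unfolding S_def using lfp_unfold[of F] by (simp add: F_def)
  define h where "h = (\<lambda>x. if x \<in> S then i x else inv_into B j x)"
  have SA: "S \<subseteq> A" using S by blast
  have AS: "A - S = j ` (B - i ` S)" using S assms(4) by blast
  have "bij_betw i S (i ` S)"
    using assms(1) SA inj_on_subset by (auto simp: bij_betw_def)
  hence b1: "bij_betw h S (i ` S)"
    by (rule bij_betw_cong[THEN iffD1, rotated]) (simp add: h_def)
  have "bij_betw (inv_into B j) (A - S) (B - i ` S)"
    using bij_betw_inv_into_subset[of j B "j ` B" "B - i ` S" "A - S"] assms(3) AS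
    by (auto simp: bij_betw_def)
  hence b2: "bij_betw h (A - S) (B - i ` S)"
    by (rule bij_betw_cong[THEN iffD1, rotated]) (simp add: h_def)
  have "bij_betw h (S \<union> (A - S)) (i ` S \<union> (B - i ` S))"
    using b1 b2 by (rule bij_betw_combine) blast
  moreover have "S \<union> (A - S) = A" "i ` S \<union> (B - i ` S) = B" using SA assms(2) by auto
  ultimately have "bij_betw h A B" by simp
  moreover have "h x = i x \<or> j (h x) = x" if "x \<in> A" for x
  proof (cases "x \<in> S")
    case False
    hence "x \<in> j ` B" using that AS by blast
    thus ?thesis using False by (simp add: h_def f_inv_into_f)
  qed (simp add: h_def)
  ultimately show ?thesis by (rule that)
qed

lemma separated_nets_linear_bijection:
  fixes X Y :: "(real ^ 'n) set"
  assumes "separated_net X" "separated_net Y"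
  obtains h L where "bij_betw h X Y" "0 \<le> L"
    "\<And>x. x \<in> X \<Longrightarrow> norm (h x - x) \<le> L * max 1 (norm x)"
proof -
  obtain i a D where i: "inj_on i X" "i ` X \<subseteq> Y" "1 \<le> a" "0 < D"
    and iD: "\<And>x. norm (i x - a *\<^sub>R x) \<le> D"
    using separated_net_injection[of X Y] assms by (auto simp: separated_net_def)
  obtain j b E where j: "inj_on j Y" "j ` Y \<subseteq> X" "1 \<le> b" "0 < E"
    and jE: "\<And>y. norm (j y - b *\<^sub>R y) \<le> E"
    using separated_net_injection[of Y X] assms by (auto simp: separated_net_def)
  obtain h where h: "bij_betw h X Y" "\<And>x. x \<in> X \<Longrightarrow> h x = i x \<or> j (h x) = x"
    using Schroeder_Bernstein_graph[OF i(1,2) j(1,2)] by blast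
  have hb: "norm (h x) \<le> (a + D + E + 1) * max 1 (norm x)" if "x \<in> X" for x
    using h(2)[OF that]
  proof
    assume "h x = i x"
    hence "norm (h x) \<le> norm (a *\<^sub>R x) + D" using iD[of x] norm_triangle_sub[of "i x" "a *\<^sub>R x"] by simp
    also have "\<dots> = a * norm x + D * 1" using i by simp
    also have "\<dots> \<le> a * max 1 (norm x) + D * max 1 (norm x)"
      using i by (intro add_mono mult_left_mono) auto
    also have "\<dots> = (a + D) * max 1 (norm x)" by (simp add: algebra_simps)
    also have "\<dots> \<le> (a + D + E + 1) * max 1 (norm x)"
      using i j by (intro mult_right_mono) auto
    finally show ?thesis .
  next
    assume *: "j (h x) = x"
    have "1 * norm (h x) \<le> b * norm (h x)" using j by (intro mult_right_mono) auto
    also have "\<dots> = norm (b *\<^sub>R h x)" using j by simp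
    also have "\<dots> \<le> norm x + E"
      using jE[of "h x"] * norm_triangle_sub[of "b *\<^sub>R h x" x] by (simp add: norm_minus_commute)
    also have "\<dots> \<le> 1 * max 1 (norm x) + E * max 1 (norm x)"
      using j mult_left_mono[of 1 "max 1 (norm x)" E] by (intro add_mono) auto
    also have "\<dots> = (1 + E) * max 1 (norm x)" by (simp add: algebra_simps)
    also have "\<dots> \<le> (a + D + E + 1) * max 1 (norm x)"
      using i j by (intro mult_right_mono) auto
    finally show ?thesis by simp
  qed
  have "norm (h x - x) \<le> (a + D + E + 2) * max 1 (norm x)" if "x \<in> X" for x
  proof -
    have "norm (h x - x) \<le> norm (h x) + norm x" by (rule norm_triangle_ineq4)
    also have "\<dots> \<le> (a + D + E + 1) * max 1 (norm x) + max 1 (norm x)"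
      using hb[OF that] by (intro add_mono) auto
    finally show ?thesis by (simp add: algebra_simps)
  qed
  with h(1) i j show ?thesis by (intro that[of h "a + D + E + 2"]) auto
qed

section \<open>The properties of an equivalence relation\<close>

context displacement_gauge
begin

lemma displacement_equivalent_refl:
  "separated_net X \<Longrightarrow> displacement_equivalent \<phi> X X"
  unfolding displacement_equivalent_iff bounded_displacement_def
  by (auto intro!: exI[of _ id] exI[of _ 0])

text \<open>
  As \<open>\<phi>\<close> grows at most linearly, \<open>f\<close> enlarges norms by at most a constant factor \<open>K\<close>; the
  displacement of \<open>g\<close> at \<open>f x\<close> is then controlled by \<open>\<phi> (K * t) \<le> K * \<phi> t\<close>.
\<close>

lemma bounded_displacement_comp:
  assumes f: "bounded_displacement X f" "f ` X \<subseteq> Y" and g: "bounded_displacement Y g"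
  shows "bounded_displacement X (g \<circ> f)"
proof -
  obtain C where C: "C \<ge> 0" "\<And>x. x \<in> X \<Longrightarrow> norm (f x - x) \<le> C * \<phi> (max 1 (norm x))"
    using f by (auto simp: bounded_displacement_def)
  obtain D where D: "D \<ge> 0" "\<And>y. y \<in> Y \<Longrightarrow> norm (g y - y) \<le> D * \<phi> (max 1 (norm y))"
    using g by (auto simp: bounded_displacement_def)
  define K where "K = 1 + C * \<phi> 1"
  have K: "1 \<le> K" using C pos[of 1] by (simp add: K_def)
  have "norm (g (f x) - x) \<le> (D * K + C) * \<phi> (max 1 (norm x))" if x: "x \<in> X" for x
  proof -
    define m where "m = max 1 (norm x)"
    have m: "1 \<le> m" "norm x \<le> m" by (auto simp: m_def)
    have fx: "norm (f x - x) \<le> C * \<phi> m" using C(2)[OF x] by (simp add: m_def)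
    have "\<phi> m \<le> m * \<phi> 1" using dilation_le[of m 1] m by simp
    from mult_left_mono[OF this C(1)] fx have "norm (f x - x) \<le> C * (m * \<phi> 1)" by linarith
    with norm_triangle_sub[of "f x" x] m have "norm (f x) \<le> K * m"
      by (simp add: K_def algebra_simps)
    moreover have "1 * 1 \<le> K * m" using m K by (intro mult_mono) auto
    ultimately have "\<phi> (max 1 (norm (f x))) \<le> \<phi> (K * m)" by (intro mono') auto
    also have "\<dots> \<le> K * \<phi> m" using K m by (intro dilation_le) auto
    finally have "D * \<phi> (max 1 (norm (f x))) \<le> D * (K * \<phi> m)"
      using D(1) by (rule mult_left_mono)
    moreover have "norm (g (f x) - f x) \<le> D * \<phi> (max 1 (norm (f x)))"
      using D(2) f(2) x by blast
    moreover have "norm (g (f x) - x) \<le> norm (g (f x) - f x) + norm (f x - x)"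
      using norm_triangle_ineq[of "g (f x) - f x" "f x - x"] by simp
    ultimately have "norm (g (f x) - x) \<le> D * (K * \<phi> m) + C * \<phi> m" using fx by linarith
    thus ?thesis by (simp add: m_def algebra_simps)
  qed
  thus ?thesis unfolding bounded_displacement_def using C D K
    by (intro exI[of _ "D * K + C"]) auto
qed

lemma displacement_equivalent_trans:
  assumes "displacement_equivalent \<phi> X Y" "displacement_equivalent \<phi> Y Z"
  shows "displacement_equivalent \<phi> X Z"
proof -
  obtain f where f: "bij_betw f X Y" "bounded_displacement X f"
    using assms(1) by (auto simp: displacement_equivalent_iff)
  obtain g where g: "bij_betw g Y Z" "bounded_displacement Y g"
    using assms(2) by (auto simp: displacement_equivalent_iff)
  have "bij_betw (g \<circ> f) X Z" using f g bij_betw_trans by blast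
  moreover have "bounded_displacement X (g \<circ> f)"
    using f g by (intro bounded_displacement_comp) (auto simp: bij_betw_def)
  ultimately show ?thesis using assms by (auto simp: displacement_equivalent_iff)
qed

lemma displacement_equivalent_if_linear:
  assumes c: "c > 0" "\<And>t. t \<ge> 1 \<Longrightarrow> c * t \<le> \<phi> t"
    and nets: "separated_net X" "separated_net Y"
  shows "displacement_equivalent \<phi> X Y"
proof -
  obtain h L where h: "bij_betw h X Y" "0 \<le> L"
    "\<And>x. x \<in> X \<Longrightarrow> norm (h x - x) \<le> L * max 1 (norm x)"
    using separated_nets_linear_bijection[OF nets] by blast
  have "norm (h x - x) \<le> (L / c) * \<phi> (max 1 (norm x))" if "x \<in> X" for x
  proof -
    have "(L / c) * (c * max 1 (norm x)) \<le> (L / c) * \<phi> (max 1 (norm x))"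
      using c h(2) by (intro mult_left_mono) auto
    with h(3)[OF that] c(1) show ?thesis by simp
  qed
  hence "bounded_displacement X h" unfolding bounded_displacement_def using c h(2)
    by (intro exI[of _ "L / c"]) auto
  with h(1) nets show ?thesis by (auto simp: displacement_equivalent_iff)
qed

text \<open>
  Beyond the radius \<open>s\<close> the map \<open>f\<close> moves a point \<open>x\<close> by at most half of its norm. This
  bounds \<open>norm x\<close> by a multiple of \<open>norm (f x)\<close>, and the displacement of \<open>f\<close> at \<open>x\<close> can be
  measured at \<open>f x\<close> instead.
\<close>

lemma bounded_displacement_inverse_if_sublinear:
  assumes sublinear: "\<And>c. c > 0 \<Longrightarrow> \<exists>t\<ge>1. \<phi> t < c * t"
    and f: "bij_betw f X Y" "bounded_displacement X f"
  shows "bounded_displacement Y (inv_into X f)"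
proof -
  obtain C where C: "C \<ge> 0" "\<And>x. x \<in> X \<Longrightarrow> norm (f x - x) \<le> C * \<phi> (max 1 (norm x))"
    using f by (auto simp: bounded_displacement_def)
  obtain s where s: "1 \<le> s" "\<phi> s < (1 / (2 * (C + 1))) * s"
    using sublinear[of "1 / (2 * (C + 1))"] C(1) by auto
  (* As \<phi> t / t is nonincreasing, its smallness at s persists beyond s. *)
  have half: "C * \<phi> t \<le> t / 2" if "s \<le> t" for t
  proof -
    have p: "0 < \<phi> t" using s that pos by simp
    have "(C + 1) * \<phi> s \<le> s / 2" using s(2) C(1) by (simp add: field_simps)
    hence "t * ((C + 1) * \<phi> s) \<le> t * (s / 2)" using s that by (intro mult_left_mono) auto
    moreover have "(C + 1) * (s * \<phi> t) \<le> (C + 1) * (t * \<phi> s)"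
      using C(1) s that by (intro mult_left_mono quotient_antimono) auto
    ultimately have "s * ((C + 1) * \<phi> t) \<le> s * (t / 2)" by (simp add: algebra_simps)
    hence "(C + 1) * \<phi> t \<le> t / 2" using s(1) by simp
    with p show ?thesis by (simp add: algebra_simps)
  qed
  (* The factor 2 serves the points of norm at least s, the factor s the remaining ones. *)
  define K where "K = 2 * s"
  have K: "1 \<le> K" using s by (simp add: K_def)
  have est: "norm (x - f x) \<le> (C * K) * \<phi> (max 1 (norm (f x)))" if x: "x \<in> X" for x
  proof -
    define m where "m = max 1 (norm (f x))"
    have m: "1 \<le> m" "norm (f x) \<le> m" by (auto simp: m_def)
    have sm: "s \<le> s * m" "m \<le> s * m" using m s by (auto simp: mult_le_cancel_left1 mult_le_cancel_right1)
    have "norm x \<le> K * m"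
    proof (cases "s \<le> norm x")
      case True
      hence "norm (f x - x) \<le> norm x / 2" using C(2)[OF x] half[OF True] s(1) by simp
      hence "norm x \<le> 2 * norm (f x)"
        using norm_triangle_sub[of x "f x"] by (simp add: norm_minus_commute)
      with m sm have "norm x \<le> 2 * (s * m)" by linarith
      thus ?thesis by (simp add: K_def mult.assoc)
    next
      case False
      with sm s have "norm x \<le> 2 * (s * m)" by linarith
      thus ?thesis by (simp add: K_def mult.assoc)
    qed
    moreover have "1 * 1 \<le> K * m" using m K by (intro mult_mono) auto
    ultimately have "\<phi> (max 1 (norm x)) \<le> \<phi> (K * m)" by (intro mono') auto
    also have "\<dots> \<le> K * \<phi> m" using K m by (intro dilation_le) auto
    finally have "C * \<phi> (max 1 (norm x)) \<le> C * (K * \<phi> m)" using C(1) by (rule mult_left_mono)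
    with C(2)[OF x] show ?thesis by (simp add: m_def norm_minus_commute mult.assoc)
  qed
  have "norm (inv_into X f y - y) \<le> (C * K) * \<phi> (max 1 (norm y))" if "y \<in> Y" for y
    using est[of "inv_into X f y"] bij_betw_inv_into_right[OF f(1) that]
      bij_betw_apply[OF bij_betw_inv_into[OF f(1)] that] by simp
  thus ?thesis unfolding bounded_displacement_def using C K
    by (intro exI[of _ "C * K"]) auto
qed

lemma displacement_equivalent_sym:
  assumes "displacement_equivalent \<phi> X Y"
  shows "displacement_equivalent \<phi> Y X"
proof (cases "\<exists>c>0. \<forall>t\<ge>1. c * t \<le> \<phi> t")
  case True
  then show ?thesis
    using assms displacement_equivalent_if_linear by (auto simp: displacement_equivalent_iff)
next
  case False
  hence sublinear: "\<exists>t\<ge>1. \<phi> t < c * t" if "c > 0" for c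
    using that by (meson not_le)
  obtain f where f: "bij_betw f X Y" "bounded_displacement X f"
    using assms by (auto simp: displacement_equivalent_iff)
  have "bij_betw (inv_into X f) Y X" using f(1) by (rule bij_betw_inv_into)
  moreover have "bounded_displacement Y (inv_into X f)"
    using sublinear f by (rule bounded_displacement_inverse_if_sublinear)
  ultimately show ?thesis using assms by (auto simp: displacement_equivalent_iff)
qed

end

theorem proposition2p7:
  fixes \<phi> :: "real \<Rightarrow> real"
  assumes "\<And>t. t > 0 \<Longrightarrow> \<phi> t > 0"
    and "mono_on {0<..} \<phi>"
    and "concave_on {0<..} \<phi>"
  shows "equiv {Z :: (real ^ 'n) set. separated_net Z}
           {(X, Y). displacement_equivalent \<phi> X Y}"
proof -
  interpret displacement_gauge \<phi>
    using assms by unfold_locales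
  show ?thesis
  proof (rule equivI)
    show "{(X, Y). displacement_equivalent \<phi> X Y}
        \<subseteq> {Z :: (real ^ 'n) set. separated_net Z} \<times> {Z. separated_net Z}"
      by (auto simp: displacement_equivalent_def)
    show "refl_on {Z :: (real ^ 'n) set. separated_net Z} {(X, Y). displacement_equivalent \<phi> X Y}"
      by (auto simp: refl_on_def displacement_equivalent_refl)
    show "sym {(X, Y :: (real ^ 'n) set). displacement_equivalent \<phi> X Y}"
      by (auto intro: symI displacement_equivalent_sym)
    show "trans {(X, Y :: (real ^ 'n) set). displacement_equivalent \<phi> X Y}"
      by (auto intro!: transI intro: displacement_equivalent_trans)
  qed
qed

end
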